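(* Let $P^*(\lambda)=\sum_{j=0}^{\gamma}\vartheta_j(\lambda)A_j$ be the $n\times n$ matrix polynomial described in the context (the numerator of the rational matrix surrogate, expressed in the Vandermonde-with-Arnoldi basis). Assume that $P^*(\lambda)$ is regular (i.e. $\det P^*(\lambda)\not\equiv 0$) and is regarded as a matrix polynomial of grade $\gamma$. Define $$C_0=\begin{bmatrix} H([\gamma],[\gamma-1])^{\mathrm T}\otimes I_n\\ -k_{\gamma-1}[A_0,A_1,\dots,A_{\gamma-1}]+k_\gamma H([\gamma],\gamma)^{\mathrm T}\otimes A_\gamma\end{bmatrix},\qquad C_1=\begin{bmatrix} I_{(\gamma-1)n}&\\ &k_\gamma A_\gamma\end{bmatrix}.$$ Then the pencil $(C_0,C_1)$, i.e. $\lambda C_1-C_0$, is a strong linearization of $P^*(\lambda)$.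
   Context: Setting: $\Omega\subset\mathbb{C}$ is a Jordan domain, $T(x)=\sum_{i=1}^s t_i(x)E_i$ with $E_i\in\mathbb{C}^{n\times n}$ constant and each $t_i$ analytic in $\Omega$ and continuous on $\bar\Omega$. Non-negative integers $n_1,\dots,n_s,d$ are prescribed, and $\mathcal X=\{x_\ell\}_{\ell=1}^m\subset\bar\Omega$ are distinct sample nodes with $m\ge\max_{1\le i\le s}(n_i+d+2)$. The vector $\boldsymbol\xi^*(x)=[p_1^*(x)/q^*(x),\dots,p_s^*(x)/q^*(x)]^{\mathrm T}$ is obtained from the discrete rational minimax problem of minimizing $\max_{x\in\mathcal X}\|[t_1(x),\dots,t_s(x)]^{\mathrm T}-\boldsymbol\xi(x)\|_2$ over all $\boldsymbol\xi=[p_1/q,\dots,p_s/q]^{\mathrm T}$ with $\deg p_i\le n_i$ and $0\not\equiv q$, $\deg q\le d$ (it is computed by a dual-based Lawson iteration called m-d-Lawson). The rational surrogate of $T$ is $R^*(x)=\frac{1}{q^*(x)}P^*(x)$ with $P^*(x)=\sum_{i=1}^s p_i^*(x)E_i$. It is assumed throughout that $q^*$ has no zeros on $\bar\Omega$. Basis: put $\gamma=\max\{\max_{1\le i\le s} n_i,\,d\}$ (with $\gamma\ge1$). The Vandermonde with Arnoldi (V+A) process, i.e. Arnoldi orthogonalization for multiplication by $x$ on the nodes $\mathcal X$, yields a discrete orthogonal polynomial basis $\{\vartheta_j\}_{j=0}^{\gamma}$ with respect to $\mathcal X$, with $\deg\vartheta_j= j$ and $\vartheta_0\equiv1$, and an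 irreducible upper Hessenberg matrix $H=(h_{i,j})\in\mathbb{C}^{(\gamma+2)\times(\gamma+1)}$ ($h_{i,j}=0$ for $i>j+1$, $h_{j+1,j}\ne0$) such that $$x[\vartheta_0(x),\dots,\vartheta_\gamma(x)]=[\vartheta_0(x),\dots,\vartheta_\gamma(x),\vartheta_{\gamma+1}(x)]\,H .$$ Writing $p_i^*(x)=\sum_{j=0}^{\gamma}a^*_{i,j}\vartheta_j(x)$, one has $P^*(x)=\sum_{j=0}^{\gamma}\vartheta_j(x)A_j$ with $A_j=\sum_{i=1}^s a^*_{i,j}E_i$. $k_j$ denotes the leading coefficient of $\vartheta_j$; thus $k_0=1$ and $h_{j+1,j}=k_{j-1}/k_j$ for $j=1,\dots,\gamma$. Notation: $[m]=\{1,\dots,m\}$; $H([\gamma],[\gamma-1])$ is the submatrix of the first $\gamma$ rows and first $\gamma-1$ columns of $H$; $H([\gamma],\gamma)$ is the vector of the first $\gamma$ entries of column $\gamma$ of $H$; $\otimes$ is the Kronecker product; $\cdot^{\mathrm T}$ is the (non-conjugate) transpose. Grade: grade $\gamma$ means that $\gamma$ is an assigned upper bound for the degree of $P^*$; the matrix $A_\gamma$ may be singular or even zero. For a matrix polynomial $P$ of grade $\gamma$ the reverse polynomial is $P^{\#}(\lambda)=\lambda^\gamma P(\lambda^{-1})$. Strong linearization: a matrix polynomial is unimodular if its determinant is a nonzero constant. A $\gamma n\times\gamma n$ pencil $\lambda A-B$ is a strong linearization of a regular $n\times n$ matrix polynomial $P(\lambda)$ of grade $\gamma$ if there are unimodular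 matrix polynomials $D,G$ with $$\begin{bmatrix}P(\lambda)&\\&I_{(\gamma-1)n}\end{bmatrix}=D(\lambda)(\lambda A-B)G(\lambda)$$ and unimodular matrix polynomials $F,K$ with $$\begin{bmatrix}P^{\#}(\lambda)&\\&I_{(\gamma-1)n}\end{bmatrix}=F(\lambda)(A-\lambda B)K(\lambda).$$ *)

theory Defs
  imports
    "HOL-Analysis.Complex_Analysis_Basics"
    "HOL-Analysis.Path_Connected"
    "HOL-Analysis.L2_Norm"
    "Jordan_Normal_Form.Determinant"
    "Jordan_Normal_Form.DL_Submatrix"
begin

section \<open>The discrete rational minimax problem\<close>

definition jordan_domain :: "complex set \<Rightarrow> bool" where
  "jordan_domain \<Omega> \<longleftrightarrow>
     (\<exists>g. simple_path g \<and> pathfinish g = pathstart g \<and> \<Omega> = inside (path_image g))"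

(* Competitors are required to have a denominator without zeros at the nodes, so that their
   error is defined. This loses no competitor with finite error: if all p_i/q stay finite at a
   zero of q, the zero is a common factor of q and all p_i and can be cancelled without
   violating the degree bounds. *)
definition rational_admissible ::
    "nat \<Rightarrow> (nat \<Rightarrow> nat) \<Rightarrow> nat \<Rightarrow> complex set \<Rightarrow> (nat \<Rightarrow> complex poly) \<Rightarrow> complex poly \<Rightarrow> bool" where
  "rational_admissible s N d X p q \<longleftrightarrow>
     (\<forall>i\<in>{1..s}. degree (p i) \<le> N i) \<and> q \<noteq> 0 \<and> degree q \<le> d \<and> (\<forall>x\<in>X. poly q x \<noteq> 0)"

definition rational_error ::
    "nat \<Rightarrow> (nat \<Rightarrow> complex \<Rightarrow> complex) \<Rightarrow> complex set \<Rightarrow> (nat \<Rightarrow> complex poly) \<Rightarrow> complex poly \<Rightarrow> real" where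
  "rational_error s t X p q =
     (MAX x\<in>X. L2_set (\<lambda>i. cmod (t i x - poly (p i) x / poly q x)) {1..s})"

definition rational_minimax_solution ::
    "nat \<Rightarrow> (nat \<Rightarrow> complex \<Rightarrow> complex) \<Rightarrow> (nat \<Rightarrow> nat) \<Rightarrow> nat \<Rightarrow> complex set
      \<Rightarrow> (nat \<Rightarrow> complex poly) \<Rightarrow> complex poly \<Rightarrow> bool" where
  "rational_minimax_solution s t N d X p q \<longleftrightarrow>
     rational_admissible s N d X p q \<and>
     (\<forall>p' q'. rational_admissible s N d X p' q' \<longrightarrow>
        rational_error s t X p q \<le> rational_error s t X p' q')"


section \<open>The Vandermonde-with-Arnoldi basis\<close>

(* Matrix indices start at 0: the mathematical entry h_{i,j} is H $$ (i - 1, j - 1), so column j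
   of H expresses x * \<theta>_j. The basis is orthogonal in the discrete inner product
   over X; its normalisation is left open apart from \<theta>_0 = 1. *)
definition VA_basis :: "complex set \<Rightarrow> nat \<Rightarrow> (nat \<Rightarrow> complex poly) \<Rightarrow> complex mat \<Rightarrow> bool" where
  "VA_basis X \<gamma> \<theta> H \<longleftrightarrow>
     \<theta> 0 = 1 \<and>
     (\<forall>j\<le>\<gamma>. degree (\<theta> j) = j) \<and>
     (\<forall>i\<le>\<gamma>. \<forall>j\<le>\<gamma>. i \<noteq> j \<longrightarrow> (\<Sum>x\<in>X. poly (\<theta> i) x * cnj (poly (\<theta> j) x)) = 0) \<and>
     H \<in> carrier_mat (\<gamma> + 2) (\<gamma> + 1) \<and>
     (\<forall>i<\<gamma> + 2. \<forall>j<\<gamma> + 1. i > j + 1 \<longrightarrow> H $$ (i, j) = 0) \<and>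
     (\<forall>j<\<gamma> + 1. H $$ (j + 1, j) \<noteq> 0) \<and>
     (\<forall>j\<le>\<gamma>. [:0, 1:] * \<theta> j = (\<Sum>i\<le>\<gamma> + 1. smult (H $$ (i, j)) (\<theta> i)))"


section \<open>Matrix polynomials\<close>

text \<open>An \<open>n \<times> n\<close> matrix polynomial is a matrix with polynomial entries.\<close>

definition basis_matpoly ::
    "nat \<Rightarrow> nat \<Rightarrow> (nat \<Rightarrow> complex poly) \<Rightarrow> (nat \<Rightarrow> complex mat) \<Rightarrow> complex poly mat" where
  "basis_matpoly n \<gamma> \<theta> A = mat n n (\<lambda>(r, c). \<Sum>j\<le>\<gamma>. smult (A j $$ (r, c)) (\<theta> j))"

definition numerator_matpoly ::
    "nat \<Rightarrow> nat \<Rightarrow> (nat \<Rightarrow> complex poly) \<Rightarrow> (nat \<Rightarrow> complex mat) \<Rightarrow> complex poly mat" where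
  "numerator_matpoly n s p E = mat n n (\<lambda>(r, c). \<Sum>i=1..s. smult (E i $$ (r, c)) (p i))"

definition coeff_matrix ::
    "nat \<Rightarrow> nat \<Rightarrow> (nat \<Rightarrow> nat \<Rightarrow> complex) \<Rightarrow> (nat \<Rightarrow> complex mat) \<Rightarrow> nat \<Rightarrow> complex mat" where
  "coeff_matrix n s a E j = mat n n (\<lambda>(r, c). \<Sum>i=1..s. a i j * E i $$ (r, c))"

lemma numerator_matpoly_eq_basis_matpoly:
  assumes "\<And>i. i \<in> {1..s} \<Longrightarrow> p i = (\<Sum>j\<le>\<gamma>. smult (a i j) (\<theta> j))"
  shows "numerator_matpoly n s p E = basis_matpoly n \<gamma> \<theta> (coeff_matrix n s a E)"
proof (rule eq_matI)
  fix r c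
  assume "r < dim_row (basis_matpoly n \<gamma> \<theta> (coeff_matrix n s a E))"
    and "c < dim_col (basis_matpoly n \<gamma> \<theta> (coeff_matrix n s a E))"
  then have rc: "r < n" "c < n"
    by (simp_all add: basis_matpoly_def)
  have "(\<Sum>i=1..s. smult (E i $$ (r, c)) (p i)) =
        (\<Sum>j\<le>\<gamma>. smult (\<Sum>i=1..s. a i j * E i $$ (r, c)) (\<theta> j))"
  proof (rule poly_eqI)
    fix m
    have "coeff (\<Sum>i=1..s. smult (E i $$ (r, c)) (p i)) m =
        (\<Sum>i=1..s. \<Sum>j\<le>\<gamma>. a i j * E i $$ (r, c) * coeff (\<theta> j) m)"
      by (simp add: coeff_sum assms sum_distrib_left mult_ac)
    also have "\<dots> = (\<Sum>j\<le>\<gamma>. \<Sum>i=1..s. a i j * E i $$ (r, c) * coeff (\<theta> j) m)"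
      by (rule sum.swap)
    finally show "coeff (\<Sum>i=1..s. smult (E i $$ (r, c)) (p i)) m =
        coeff (\<Sum>j\<le>\<gamma>. smult (\<Sum>i=1..s. a i j * E i $$ (r, c)) (\<theta> j)) m"
      by (simp add: coeff_sum sum_distrib_right)
  qed
  then show "numerator_matpoly n s p E $$ (r, c) =
      basis_matpoly n \<gamma> \<theta> (coeff_matrix n s a E) $$ (r, c)"
    using rc by (simp add: numerator_matpoly_def basis_matpoly_def coeff_matrix_def)
qed (simp_all add: numerator_matpoly_def basis_matpoly_def)

definition regular_matpoly :: "complex poly mat \<Rightarrow> bool" where
  "regular_matpoly P \<longleftrightarrow> det P \<noteq> 0"

definition has_grade :: "nat \<Rightarrow> complex poly mat \<Rightarrow> bool" where
  "has_grade \<gamma> P \<longleftrightarrow> (\<forall>r<dim_row P. \<forall>c<dim_col P. degree (P $$ (r, c)) \<le> \<gamma>)"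

(* Reversal with respect to the grade, not to the actual degree (cf. reflect_poly). *)
definition rev_poly :: "nat \<Rightarrow> complex poly \<Rightarrow> complex poly" where
  "rev_poly \<gamma> p = (\<Sum>j\<le>\<gamma>. monom (coeff p j) (\<gamma> - j))"

lemma poly_rev_poly:
  assumes "degree p \<le> \<gamma>" and "x \<noteq> 0"
  shows "poly (rev_poly \<gamma> p) x = x ^ \<gamma> * poly p (inverse x)"
proof -
  have "poly p (inverse x) = (\<Sum>j\<le>\<gamma>. coeff p j * inverse x ^ j)"
    unfolding poly_altdef using assms(1)
    by (intro sum.mono_neutral_left) (auto simp: coeff_eq_0)
  then show ?thesis
    using assms(2)
    by (simp add: rev_poly_def poly_sum poly_monom sum_distrib_left power_diff field_simps)
qed

definition rev_matpoly :: "nat \<Rightarrow> complex poly mat \<Rightarrow> complex poly mat" where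
  "rev_matpoly \<gamma> P = map_mat (rev_poly \<gamma>) P"

definition unimodular_matpoly :: "nat \<Rightarrow> complex poly mat \<Rightarrow> bool" where
  "unimodular_matpoly N U \<longleftrightarrow> U \<in> carrier_mat N N \<and> (\<exists>c. c \<noteq> 0 \<and> det U = [:c:])"

definition block_diag :: "'a::zero mat \<Rightarrow> 'a mat \<Rightarrow> 'a mat" where
  "block_diag A B =
     four_block_mat A (0\<^sub>m (dim_row A) (dim_col B)) (0\<^sub>m (dim_row B) (dim_col A)) B"

abbreviation const_matpoly :: "complex mat \<Rightarrow> complex poly mat" where
  "const_matpoly A \<equiv> map_mat (\<lambda>c. [:c:]) A"

abbreviation lam :: "complex poly" where
  "lam \<equiv> [:0, 1:]"

text \<open>\<open>strong_linearization n \<gamma> P A B\<close>: the pencil \<open>\<lambda> A - B\<close> is a strong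
  linearization of \<open>P\<close>, regarded as an \<open>n \<times> n\<close> matrix polynomial of grade \<open>\<gamma>\<close>.\<close>

definition strong_linearization ::
    "nat \<Rightarrow> nat \<Rightarrow> complex poly mat \<Rightarrow> complex mat \<Rightarrow> complex mat \<Rightarrow> bool" where
  "strong_linearization n \<gamma> P A B \<longleftrightarrow>
     P \<in> carrier_mat n n \<and> has_grade \<gamma> P \<and> regular_matpoly P \<and>
     A \<in> carrier_mat (\<gamma> * n) (\<gamma> * n) \<and> B \<in> carrier_mat (\<gamma> * n) (\<gamma> * n) \<and>
     (\<exists>D G. unimodular_matpoly (\<gamma> * n) D \<and> unimodular_matpoly (\<gamma> * n) G \<and>
        block_diag P (1\<^sub>m ((\<gamma> - 1) * n)) =
          D * (lam \<cdot>\<^sub>m const_matpoly A - const_matpoly B) * G) \<and>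
     (\<exists>F K. unimodular_matpoly (\<gamma> * n) F \<and> unimodular_matpoly (\<gamma> * n) K \<and>
        block_diag (rev_matpoly \<gamma> P) (1\<^sub>m ((\<gamma> - 1) * n)) =
          F * (const_matpoly A - lam \<cdot>\<^sub>m const_matpoly B) * K)"


section \<open>Block matrices\<close>

definition kronecker :: "'a::times mat \<Rightarrow> 'a mat \<Rightarrow> 'a mat" where
  "kronecker A B = mat (dim_row A * dim_row B) (dim_col A * dim_col B)
     (\<lambda>(i, j). A $$ (i div dim_row B, j div dim_col B) * B $$ (i mod dim_row B, j mod dim_col B))"

text \<open>The block row \<open>[A 0, \<dots>, A (\<gamma> - 1)]\<close> of \<open>n \<times> n\<close> blocks.\<close>

definition block_row :: "nat \<Rightarrow> nat \<Rightarrow> (nat \<Rightarrow> 'a mat) \<Rightarrow> 'a mat" where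
  "block_row n \<gamma> A = mat n (\<gamma> * n) (\<lambda>(i, j). A (j div n) $$ (i, j mod n))"

end

theory Submission
  imports Defs
begin

text \<open>Write \<open>L(\<lambda>) = \<lambda> C\<^sub>1 - C\<^sub>0\<close> and let \<open>\<Theta>\<close> be the column of the basis polynomials
  \<open>\<theta> 0, \<dots>, \<theta> (\<gamma> - 1)\<close>, each multiplied by the identity matrix. The first \<open>\<gamma> - 1\<close> block rows of \<open>L\<close>
  are the recurrence of the basis, so they annihilate \<open>\<Theta>\<close>. In the last block row the
  recurrence for \<open>\<lambda> \<theta> (\<gamma> - 1)\<close> produces the missing term with \<open>\<theta> \<gamma>\<close>, with the
  factor \<open>h\<^bsub>\<gamma>,\<gamma>-1\<^esub> k\<^bsub>\<gamma>\<^esub> = k\<^bsub>\<gamma>-1\<^esub>\<close>, and the result is \<open>k\<^bsub>\<gamma>-1\<^esub> P\<close>. Hence \<open>L \<Theta>\<close> has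
  the single nonzero block \<open>k\<^bsub>\<gamma>-1\<^esub> P\<close>, and the same computation for reversed polynomials gives
  the single block \<open>k\<^bsub>\<gamma>-1\<^esub> P\<^sup>#\<close> for the reversed pencil \<open>C\<^sub>1 - \<lambda> C\<^sub>0\<close>.

  To turn this into a unimodular equivalence, the column is completed to a unimodular matrix \<open>G\<close>
  such that the other columns of the product, in the first \<open>\<gamma> - 1\<close> block rows, form a unimodular
  block. Then the product is a block antitriangular (or, after a column permutation, such) matrix
  whose corner \<open>k\<^bsub>\<gamma>-1\<^esub> P\<close> splits off: lemmas \<open>equivalent_block_diag_left\<close> and
  \<open>equivalent_block_diag_right\<close>.

  For \<open>L\<close> the column \<open>\<Theta>\<close> starts with \<open>\<theta> 0 = 1\<close>, so unit columns complete it, and the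
  subdiagonal of the Hessenberg matrix makes the remaining block triangular with nonzero constant
  diagonal (\<open>linearization_pencil\<close>). For the reversed pencil the completion consists of the
  reversals of the basis polynomials truncated at the degrees \<open>0, \<dots>, \<gamma> - 2\<close>; the recurrence
  maps them to the constant triangular matrix of coefficients of the basis
  (\<open>linearization_reversed_pencil\<close>). Neither argument divides by \<open>A \<gamma>\<close>, so the
  leading coefficient may be singular.\<close>

section \<open>Block matrices\<close>

text \<open>The entry in row \<open>r\<close> and column \<open>s\<close> of block \<open>(b, c)\<close> is \<open>F b c r s\<close>. Giving all
  blocks by one function of four indices lets a product with a scalar block matrix be computed
  without any block decomposition.\<close>
definition block_mat :: "nat \<Rightarrow> nat \<Rightarrow> nat \<Rightarrow> (nat \<Rightarrow> nat \<Rightarrow> nat \<Rightarrow> nat \<Rightarrow> 'a) \<Rightarrow> 'a mat" where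
  "block_mat n R C F = mat (R * n) (C * n) (\<lambda>(i, j). F (i div n) (j div n) (i mod n) (j mod n))"

text \<open>The blocks of the Kronecker product of \<open>G\<close> with the identity matrix.\<close>
definition scalar_blocks :: "(nat \<Rightarrow> nat \<Rightarrow> 'a::zero) \<Rightarrow> nat \<Rightarrow> nat \<Rightarrow> nat \<Rightarrow> nat \<Rightarrow> 'a" where
  "scalar_blocks G b c r s = (if r = s then G b c else 0)"

lemma block_mat_carrier [simp]: "block_mat n R C F \<in> carrier_mat (R * n) (C * n)"
  by (simp add: block_mat_def)

lemma block_mat_dim [simp]:
  "dim_row (block_mat n R C F) = R * n" "dim_col (block_mat n R C F) = C * n"
  by (simp_all add: block_mat_def)

lemma block_mat_cong:
  assumes "\<And>b c r s. b < R \<Longrightarrow> c < C \<Longrightarrow> r < n \<Longrightarrow> s < n \<Longrightarrow> F b c r s = G b c r s"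
  shows "block_mat n R C F = block_mat n R C G"
proof (rule eq_matI)
  fix i j assume "i < dim_row (block_mat n R C G)" "j < dim_col (block_mat n R C G)"
  then have ij: "i < R * n" "j < C * n" by simp_all
  then have "n > 0" by (cases n) auto
  with ij show "block_mat n R C F $$ (i, j) = block_mat n R C G $$ (i, j)"
    by (simp add: block_mat_def less_mult_imp_div_less assms)
qed simp_all

lemma sum_div_mod:
  fixes f :: "nat \<Rightarrow> nat \<Rightarrow> 'a::comm_monoid_add"
  shows "(\<Sum>l<K * n. f (l div n) (l mod n)) = (\<Sum>k<K. \<Sum>t<n. f k t)"
proof -
  have "(\<Sum>l=k * n..<k * n + n. f (l div n) (l mod n)) = (\<Sum>t<n. f k t)" for k
  proof -
    have "(\<Sum>l=k * n..<k * n + n. f (l div n) (l mod n))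
        = (\<Sum>t=0..<n. f ((t + k * n) div n) ((t + k * n) mod n))"
      using sum.shift_bounds_nat_ivl[of "\<lambda>l. f (l div n) (l mod n)" 0 "k * n" n]
      by (simp add: add.commute)
    also have "\<dots> = (\<Sum>t<n. f k t)"
      by (rule sum.cong) auto
    finally show ?thesis .
  qed
  then show ?thesis
    by (simp add: sum.nat_group[symmetric])
qed

lemma smult_one_mat: "(1::'a::semiring_1) \<cdot>\<^sub>m A = A"
  by (rule eq_matI) auto

lemma block_mat_times_scalar_blocks:
  fixes F :: "nat \<Rightarrow> nat \<Rightarrow> nat \<Rightarrow> nat \<Rightarrow> 'a::comm_semiring_0"
  shows "block_mat n R K F * block_mat n K C (scalar_blocks G)
    = block_mat n R C (\<lambda>b c r s. \<Sum>l<K. F b l r s * G l c)"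
proof (rule eq_matI)
  fix i j assume "i < dim_row (block_mat n R C (\<lambda>b c r s. \<Sum>l<K. F b l r s * G l c))"
    "j < dim_col (block_mat n R C (\<lambda>b c r s. \<Sum>l<K. F b l r s * G l c))"
  then have ij: "i < R * n" "j < C * n" by simp_all
  then have n: "n > 0" by (cases n) auto
  have "(block_mat n R K F * block_mat n K C (scalar_blocks G)) $$ (i, j)
    = (\<Sum>l<K * n. F (i div n) (l div n) (i mod n) (l mod n)
        * scalar_blocks G (l div n) (j div n) (l mod n) (j mod n))"
    using ij by (simp add: block_mat_def scalar_prod_def atLeast0LessThan)
  also have "\<dots> = (\<Sum>k<K. \<Sum>t<n. F (i div n) k (i mod n) t * scalar_blocks G k (j div n) t (j mod n))"
    by (rule sum_div_mod)
  also have "\<dots> = (\<Sum>k<K. F (i div n) k (i mod n) (j mod n) * G k (j div n))"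
    using n by (simp add: scalar_blocks_def if_distrib[of "\<lambda>x. _ * x"] sum.delta cong: if_cong)
  finally show "(block_mat n R K F * block_mat n K C (scalar_blocks G)) $$ (i, j)
     = block_mat n R C (\<lambda>b c r s. \<Sum>l<K. F b l r s * G l c) $$ (i, j)"
    using ij by (simp add: block_mat_def)
qed simp_all

text \<open>Isolates the block row and the block column through which the matrix polynomial enters.\<close>
lemma block_mat_split:
  "block_mat n (R + R') (C + C') F = four_block_mat
     (block_mat n R C F) (block_mat n R C' (\<lambda>b c. F b (C + c)))
     (block_mat n R' C (\<lambda>b. F (R + b))) (block_mat n R' C' (\<lambda>b c. F (R + b) (C + c)))"
proof (rule eq_matI)
  fix i j
  assume "i < dim_row (four_block_mat
     (block_mat n R C F) (block_mat n R C' (\<lambda>b c. F b (C + c)))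
     (block_mat n R' C (\<lambda>b. F (R + b))) (block_mat n R' C' (\<lambda>b c. F (R + b) (C + c))))"
   and "j < dim_col (four_block_mat
     (block_mat n R C F) (block_mat n R C' (\<lambda>b c. F b (C + c)))
     (block_mat n R' C (\<lambda>b. F (R + b))) (block_mat n R' C' (\<lambda>b c. F (R + b) (C + c))))"
  then have ij: "i < R * n + R' * n" "j < C * n + C' * n" by simp_all
  then have n: "n > 0" by (cases n) auto
  have shift: "B + (l - B * n) div n = l div n" "(l - B * n) mod n = l mod n" if "\<not> l < B * n" for l B
  proof -
    have l: "l = (l - B * n) + B * n" using that by simp
    show "B + (l - B * n) div n = l div n" using n by (subst (2) l) simp
    show "(l - B * n) mod n = l mod n" by (subst (2) l) simp
  qed
  show "block_mat n (R + R') (C + C') F $$ (i, j) = four_block_mat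
     (block_mat n R C F) (block_mat n R C' (\<lambda>b c. F b (C + c)))
     (block_mat n R' C (\<lambda>b. F (R + b))) (block_mat n R' C' (\<lambda>b c. F (R + b) (C + c))) $$ (i, j)"
    using ij by (auto simp: block_mat_def shift add_mult_distrib)
qed (simp_all add: add_mult_distrib)

text \<open>An index above the diagonal either lies in a block above the diagonal, or lies strictly
  above the diagonal of a diagonal block, which is a multiple of the identity.\<close>
lemma scalar_blocks_lower_triangular:
  assumes n: "n > 0" and tri: "\<And>b c. b < c \<Longrightarrow> c < N \<Longrightarrow> G b c = 0"
    and ij: "i < j" "j < N * n"
  shows "block_mat n N N (scalar_blocks G) $$ (i, j) = 0"
proof -
  have le: "i div n \<le> j div n" using ij by (simp add: div_le_mono)
  have "i mod n \<noteq> j mod n" if "i div n = j div n"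
    using that ij by (metis div_mult_mod_eq less_irrefl)
  then show ?thesis
    using tri[of "i div n" "j div n"] le ij
    by (auto simp: block_mat_def scalar_blocks_def less_mult_imp_div_less le_less)
qed

section \<open>Unimodular matrix polynomials\<close>

lemma unimodular_matpoly_iff:
  "unimodular_matpoly N U \<longleftrightarrow> U \<in> carrier_mat N N \<and> det U dvd 1"
  by (auto simp: unimodular_matpoly_def is_unit_poly_iff dvd_field_iff)

lemma unimodular_matpoly_mult:
  assumes "unimodular_matpoly N U" "unimodular_matpoly N V"
  shows "unimodular_matpoly N (U * V)"
  using assms by (auto simp: unimodular_matpoly_iff det_mult)

lemma unimodular_matpolyI_right_inverse:
  assumes "U \<in> carrier_mat N N" "V \<in> carrier_mat N N" "U * V = 1\<^sub>m N"
  shows "unimodular_matpoly N U"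
  using assms det_mult[of U N V] by (auto simp: unimodular_matpoly_iff intro: dvdI)

text \<open>Since the determinant is a constant, the division in Cramer's rule stays within polynomials.\<close>
lemma unimodular_matpoly_inverse:
  assumes "unimodular_matpoly N U"
  obtains V where "unimodular_matpoly N V" "V * U = 1\<^sub>m N" "U * V = 1\<^sub>m N"
proof -
  obtain c where U: "U \<in> carrier_mat N N" and c: "c \<noteq> 0" "det U = [:c:]"
    using assms by (auto simp: unimodular_matpoly_def)
  define V where "V = [:inverse c:] \<cdot>\<^sub>m adj_mat U"
  have V: "V \<in> carrier_mat N N" using adj_mat(1)[OF U] by (simp add: V_def)
  have scale: "[:inverse c:] \<cdot>\<^sub>m ([:c:] \<cdot>\<^sub>m 1\<^sub>m N) = (1\<^sub>m N :: complex poly mat)"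
    using c by (auto simp: one_pCons)
  have UV: "U * V = 1\<^sub>m N"
    using adj_mat[OF U] c scale by (simp add: V_def mult_smult_distrib[OF U])
  have VU: "V * U = 1\<^sub>m N"
    using adj_mat[OF U] c scale by (simp add: V_def mult_smult_assoc_mat[OF _ U])
  show ?thesis
    using that[of V] V VU UV U unimodular_matpolyI_right_inverse by blast
qed

lemma unimodular_scalar_blocks_lower:
  assumes n: "n > 0" and tri: "\<And>b c. b < c \<Longrightarrow> c < N \<Longrightarrow> G b c = 0"
    and diag: "\<And>b. b < N \<Longrightarrow> G b b dvd 1"
  shows "unimodular_matpoly (N * n) (block_mat n N N (scalar_blocks G))"
proof -
  let ?B = "block_mat n N N (scalar_blocks G)"
  have "det ?B = prod_list (diag_mat ?B)"
    by (rule det_lower_triangular[OF scalar_blocks_lower_triangular[OF n tri] block_mat_carrier])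
  also have "\<dots> = (\<Prod>i=0..<N * n. ?B $$ (i, i))"
    by (simp add: prod_list_diag_prod)
  also have "\<dots> dvd (\<Prod>i=0..<N * n. 1)"
    by (rule prod_dvd_prod)
       (simp add: block_mat_def scalar_blocks_def diag less_mult_imp_div_less)
  finally show ?thesis
    by (simp add: unimodular_matpoly_iff)
qed

lemma unimodular_scalar_blocks_upper:
  assumes n: "n > 0" and tri: "\<And>b c. c < b \<Longrightarrow> b < N \<Longrightarrow> G b c = 0"
    and diag: "\<And>b. b < N \<Longrightarrow> G b b dvd 1"
  shows "unimodular_matpoly (N * n) (block_mat n N N (scalar_blocks G))"
proof -
  let ?B = "block_mat n N N (scalar_blocks G)"
  have "unimodular_matpoly (N * n) (block_mat n N N (scalar_blocks (\<lambda>b c. G c b)))"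
    by (rule unimodular_scalar_blocks_lower[OF n]) (use tri diag in auto)
  moreover have "block_mat n N N (scalar_blocks (\<lambda>b c. G c b)) = transpose_mat ?B"
    by (rule eq_matI) (auto simp: block_mat_def scalar_blocks_def)
  ultimately show ?thesis
    by (simp add: unimodular_matpoly_iff det_transpose[of ?B "N * n"])
qed

text \<open>The inverse can be written down blockwise, which avoids the sign of the determinant.\<close>
lemma unimodular_antitriangular:
  assumes M: "unimodular_matpoly m M" and W: "W \<in> carrier_mat n m" and \<kappa>: "\<kappa> \<noteq> 0"
  shows "unimodular_matpoly (m + n) (four_block_mat (0\<^sub>m m n) M ([:\<kappa>:] \<cdot>\<^sub>m 1\<^sub>m n) W)"
proof -
  obtain M' where M': "unimodular_matpoly m M'" "M' * M = 1\<^sub>m m" "M * M' = 1\<^sub>m m"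
    using unimodular_matpoly_inverse[OF M] by metis
  have cM: "M \<in> carrier_mat m m" "M' \<in> carrier_mat m m"
    using M M' by (auto simp: unimodular_matpoly_def)
  let ?U = "four_block_mat (0\<^sub>m m n) M ([:\<kappa>:] \<cdot>\<^sub>m 1\<^sub>m n) W"
  \<comment> \<open>The system \<open>M y = u\<close>, \<open>\<kappa> x + W y = v\<close> has the
    solution \<open>y = M' u\<close>, \<open>x = (v - W M' u) / \<kappa>\<close>.\<close>
  let ?V = "four_block_mat ([:inverse \<kappa>:] \<cdot>\<^sub>m (- W * M')) ([:inverse \<kappa>:] \<cdot>\<^sub>m 1\<^sub>m n) M' (0\<^sub>m m n)"
  have c: "- W * M' \<in> carrier_mat n m" "W * M' \<in> carrier_mat n m" using W cM by auto
  have scale: "[:\<kappa>:] \<cdot>\<^sub>m ([:inverse \<kappa>:] \<cdot>\<^sub>m Q) = Q" if "Q \<in> carrier_mat i j" for Q i j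
    using \<kappa> by (intro eq_matI) (auto simp: mult.assoc[symmetric] one_pCons[symmetric])
  have 1: "([:\<kappa>:] \<cdot>\<^sub>m 1\<^sub>m n) * ([:inverse \<kappa>:] \<cdot>\<^sub>m (- W * M')) = - W * M'"
    using c by (subst mult_smult_assoc_mat[of _ n n _ m]) (auto simp: scale[OF c(1)])
  have 2: "([:\<kappa>:] \<cdot>\<^sub>m 1\<^sub>m n) * ([:inverse \<kappa>:] \<cdot>\<^sub>m 1\<^sub>m n) = (1\<^sub>m n :: complex poly mat)"
    by (subst mult_smult_assoc_mat[of _ n n _ n]) (auto simp: scale[of _ n n])
  have 3: "- W * M' + W * M' = 0\<^sub>m n m"
    using W cM by (simp add: uminus_mult_left_mat uminus_l_inv_mat)
  have "?U * ?V = four_block_mat (1\<^sub>m m) (0\<^sub>m m n) (0\<^sub>m n m) (1\<^sub>m n)"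
    using W cM M' c
    by (subst mult_four_block_mat[of _ m n _ m _ n])
       (auto simp: 1 2 3 simp del: uminus_mult_left_mat)
  also have "\<dots> = 1\<^sub>m (m + n)" by (rule eq_matI) auto
  finally have "?U * ?V = 1\<^sub>m (m + n)" .
  moreover have "?U \<in> carrier_mat (m + n) (m + n)" "?V \<in> carrier_mat (m + n) (m + n)"
    using W cM c by (auto intro!: carrier_matI)
  ultimately show ?thesis using unimodular_matpolyI_right_inverse by blast
qed

text \<open>How a linearization arises: if the first block column of \<open>L * G\<close> is zero except for a
  multiple of \<open>P\<close> at the bottom, then \<open>P\<close> can be pulled out of that column to the right, and what
  remains is the unimodular matrix of the preceding lemma.\<close>
lemma equivalent_block_diag_left:
  assumes P: "P \<in> carrier_mat n n" and M: "unimodular_matpoly m M" and W: "W \<in> carrier_mat n m"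
    and \<kappa>: "\<kappa> \<noteq> 0" and L: "L \<in> carrier_mat (m + n) (m + n)" and G: "unimodular_matpoly (m + n) G"
    and LG: "L * G = four_block_mat (0\<^sub>m m n) M ([:\<kappa>:] \<cdot>\<^sub>m P) W"
  shows "\<exists>D G. unimodular_matpoly (m + n) D \<and> unimodular_matpoly (m + n) G \<and>
    block_diag P (1\<^sub>m m) = D * L * G"
proof -
  let ?E = "four_block_mat (0\<^sub>m m n) M ([:\<kappa>:] \<cdot>\<^sub>m 1\<^sub>m n) W"
  obtain D where D: "unimodular_matpoly (m + n) D" "D * ?E = 1\<^sub>m (m + n)"
    using unimodular_matpoly_inverse[OF unimodular_antitriangular[OF M W \<kappa>]] by metis
  have cM: "M \<in> carrier_mat m m" using M by (auto simp: unimodular_matpoly_def)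
  have c: "D \<in> carrier_mat (m + n) (m + n)" "G \<in> carrier_mat (m + n) (m + n)"
    using D G by (auto simp: unimodular_matpoly_def)
  have cE: "?E \<in> carrier_mat (m + n) (m + n)" "block_diag P (1\<^sub>m m) \<in> carrier_mat (m + n) (m + n)"
    using W cM P by (auto simp: block_diag_def intro!: carrier_matI)
  have "?E * block_diag P (1\<^sub>m m) = L * G"
    unfolding LG block_diag_def using P W cM
    by (subst mult_four_block_mat[of _ m n _ m _ n]) (auto simp: mult_smult_assoc_mat[of _ n n _ n])
  then have "D * L * G = D * (?E * block_diag P (1\<^sub>m m))"
    using assoc_mult_mat[OF c(1) L c(2)] by simp
  also have "\<dots> = block_diag P (1\<^sub>m m)"
    using assoc_mult_mat[OF c(1) cE] cE D by simp
  finally show ?thesis using D G by metis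
qed

text \<open>The variant with \<open>P\<close> in the last block column reduces to the previous one by moving that
  column to the front.\<close>
lemma equivalent_block_diag_right:
  assumes P: "P \<in> carrier_mat n n" and M: "unimodular_matpoly m M" and W: "W \<in> carrier_mat n m"
    and \<kappa>: "\<kappa> \<noteq> 0" and L: "L \<in> carrier_mat (m + n) (m + n)" and G: "unimodular_matpoly (m + n) G"
    and LG: "L * G = four_block_mat M (0\<^sub>m m n) W ([:\<kappa>:] \<cdot>\<^sub>m P)"
  shows "\<exists>D G. unimodular_matpoly (m + n) D \<and> unimodular_matpoly (m + n) G \<and>
    block_diag P (1\<^sub>m m) = D * L * G"
proof -
  let ?S = "four_block_mat (0\<^sub>m m n) (1\<^sub>m m) (1\<^sub>m n) (0\<^sub>m n m) :: complex poly mat"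
  have "unimodular_matpoly m (1\<^sub>m m)" by (simp add: unimodular_matpoly_iff)
  from unimodular_antitriangular[OF this, of "0\<^sub>m n m" n 1]
  have S: "unimodular_matpoly (m + n) ?S"
    by (simp add: one_pCons[symmetric] smult_one_mat)
  have cM: "M \<in> carrier_mat m m" using M by (auto simp: unimodular_matpoly_def)
  have c: "?S \<in> carrier_mat (m + n) (m + n)" "G \<in> carrier_mat (m + n) (m + n)"
    using S G by (auto simp: unimodular_matpoly_def)
  have "L * (G * ?S) = (L * G) * ?S" using assoc_mult_mat[OF L c(2) c(1)] by simp
  also have "\<dots> = four_block_mat (0\<^sub>m m n) M ([:\<kappa>:] \<cdot>\<^sub>m P) W"
    unfolding LG using P W cM
    by (subst mult_four_block_mat[of _ m m _ n _ n]) auto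
  finally show ?thesis
    by (rule equivalent_block_diag_left[OF P M W \<kappa> L unimodular_matpoly_mult[OF G S]])
qed

section \<open>Reversal of polynomials\<close>

lemma smult_sum_right: "smult z (\<Sum>i\<in>I. f i) = (\<Sum>i\<in>I. smult z (f i))"
  using sum_distrib_left[of "[:z:]" f I] by simp

lemma coeff_rev_poly: "coeff (rev_poly c p) i = (if i \<le> c then coeff p (c - i) else 0)"
proof -
  have "coeff (rev_poly c p) i = (\<Sum>j\<le>c. if c - j = i then coeff p j else 0)"
    by (simp add: rev_poly_def coeff_sum)
  also have "\<dots> = (\<Sum>j\<le>c. if j = c - i \<and> i \<le> c then coeff p j else 0)"
    by (rule sum.cong) auto
  also have "\<dots> = (if i \<le> c then coeff p (c - i) else 0)"
    by (cases "i \<le> c") simp_all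
  finally show ?thesis .
qed

lemma rev_poly_add: "rev_poly c (p + q) = rev_poly c p + rev_poly c q"
  by (rule poly_eqI) (simp add: coeff_rev_poly)

lemma rev_poly_0 [simp]: "rev_poly c 0 = 0"
  by (rule poly_eqI) (simp add: coeff_rev_poly)

lemma rev_poly_smult: "rev_poly c (smult z p) = smult z (rev_poly c p)"
  by (rule poly_eqI) (simp add: coeff_rev_poly)

lemma rev_poly_sum: "rev_poly c (\<Sum>i\<in>I. f i) = (\<Sum>i\<in>I. rev_poly c (f i))"
  by (induction I rule: infinite_finite_induct) (simp_all add: rev_poly_add)

text \<open>Below the degree of \<open>p\<close>, \<open>rev_poly c p\<close> reverses the truncation of \<open>p\<close> at degree \<open>c\<close>. Raising
  \<open>c\<close> by one multiplies by the variable and brings in one more coefficient as constant term;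
  multiplying \<open>p\<close> by the variable as well cancels the effect.\<close>
lemma rev_poly_Suc: "rev_poly (Suc c) p = lam * rev_poly c p + [:coeff p (Suc c):]"
proof (rule poly_eqI)
  fix i
  show "coeff (rev_poly (Suc c) p) i = coeff (lam * rev_poly c p + [:coeff p (Suc c):]) i"
    by (cases i) (auto simp: coeff_rev_poly)
qed

lemma rev_poly_Suc_lam: "rev_poly (Suc c) (lam * p) = rev_poly c p"
  by (rule poly_eqI) (auto simp: coeff_rev_poly Suc_diff_le le_Suc_eq)

lemma rev_poly_zero_grade: "rev_poly 0 p = [:coeff p 0:]"
  by (simp add: rev_poly_def monom_0)

section \<open>Pencils of a Hessenberg recurrence\<close>

text \<open>A degree-graded basis whose multiplication by the variable has a Hessenberg matrix \<open>h\<close>. With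
  \<open>m = \<gamma> - 1\<close> the pencil has \<open>m + 1\<close> block rows, and all indices count from 0.\<close>
locale hessenberg_recurrence =
  fixes m :: nat and h :: "nat \<Rightarrow> nat \<Rightarrow> complex" and \<theta> :: "nat \<Rightarrow> complex poly"
  assumes start: "\<theta> 0 = 1"
    and deg: "\<And>j. j \<le> Suc m \<Longrightarrow> degree (\<theta> j) = j"
    and hess: "\<And>i j. i > j + 1 \<Longrightarrow> i \<le> Suc m \<Longrightarrow> j \<le> m \<Longrightarrow> h i j = 0"
    and subdiag: "\<And>j. j \<le> m \<Longrightarrow> h (Suc j) j \<noteq> 0"
    and recurrence: "\<And>j. j \<le> m \<Longrightarrow> lam * \<theta> j = (\<Sum>i\<le>Suc m. smult (h i j) (\<theta> i))"
begin

lemma recurrence_inner: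
  assumes "j < m"
  shows "lam * \<theta> j = (\<Sum>i\<le>m. smult (h i j) (\<theta> i))"
  using recurrence[of j] hess[of j "Suc m"] assms by simp

lemma lead_coeff_nonzero: "j \<le> Suc m \<Longrightarrow> lead_coeff (\<theta> j) \<noteq> 0"
  by (rule leading_coeff_neq_0) (use deg[of j] start in auto)

text \<open>Comparison of the coefficients of degree \<open>m + 1\<close> in the recurrence for \<open>\<theta> m\<close>.\<close>
lemma lead_coeff_step: "h (Suc m) m * lead_coeff (\<theta> (Suc m)) = lead_coeff (\<theta> m)"
proof -
  have "coeff (lam * \<theta> m) (Suc m) = (\<Sum>i\<le>Suc m. h i m * coeff (\<theta> i) (Suc m))"
    by (subst recurrence) (simp_all add: coeff_sum del: sum.atMost_Suc)
  also have "\<dots> = h (Suc m) m * coeff (\<theta> (Suc m)) (Suc m)"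
    by (simp add: coeff_eq_0 deg)
  finally show ?thesis by (simp add: deg)
qed

text \<open>The blocks of the two coefficient matrices: the block rows \<open>b < m\<close> encode the recurrence,
  the last one encodes the matrix polynomial.\<close>
definition C1_blocks :: "(nat \<Rightarrow> complex mat) \<Rightarrow> nat \<Rightarrow> nat \<Rightarrow> nat \<Rightarrow> nat \<Rightarrow> complex" where
  "C1_blocks A b c r s =
     (if b < m then (if b = c \<and> r = s then 1 else 0)
      else if c = m then lead_coeff (\<theta> (Suc m)) * A (Suc m) $$ (r, s) else 0)"

definition C0_blocks :: "(nat \<Rightarrow> complex mat) \<Rightarrow> nat \<Rightarrow> nat \<Rightarrow> nat \<Rightarrow> nat \<Rightarrow> complex" where
  "C0_blocks A b c r s =
     (if b < m then (if r = s then h c b else 0)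
      else lead_coeff (\<theta> (Suc m)) * h c m * A (Suc m) $$ (r, s) - lead_coeff (\<theta> m) * A c $$ (r, s))"

text \<open>The next two lemmas apply the homogeneous pencil \<open>x C\<^sub>1 - y C\<^sub>0\<close> to a vector \<open>v\<close>.
  The values \<open>x = lam\<close>, \<open>y = 1\<close> give the pencil itself and \<open>x = 1\<close>, \<open>y = lam\<close> its reversal.\<close>
lemma pencil_top:
  assumes b: "b < m"
  shows "(\<Sum>l\<le>m. (x * [:C1_blocks A b l r s:] - y * [:C0_blocks A b l r s:]) * v l)
    = (if r = s then x * v b - y * (\<Sum>l\<le>m. smult (h l b) (v l)) else 0)"
proof (cases "r = s")
  case True
  have "(\<Sum>l\<le>m. (x * [:C1_blocks A b l r s:] - y * [:C0_blocks A b l r s:]) * v l)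
    = (\<Sum>l\<le>m. (if l = b then x * v l else 0) - y * smult (h l b) (v l))"
    using b True by (intro sum.cong) (auto simp: C1_blocks_def C0_blocks_def algebra_simps)
  also have "\<dots> = x * v b - y * (\<Sum>l\<le>m. smult (h l b) (v l))"
    using b by (subst sum_subtractf) (simp add: sum_distrib_left del: sum.atMost_Suc)
  finally show ?thesis using True by simp
qed (use b in \<open>simp add: C1_blocks_def C0_blocks_def\<close>)

lemma pencil_bottom:
  "(\<Sum>l\<le>m. (x * [:C1_blocks A m l r s:] - y * [:C0_blocks A m l r s:]) * v l)
    = smult (lead_coeff (\<theta> (Suc m)) * A (Suc m) $$ (r, s))
        (x * v m - y * (\<Sum>l\<le>m. smult (h l m) (v l)))
      + smult (lead_coeff (\<theta> m)) (\<Sum>l\<le>m. smult (A l $$ (r, s)) (y * v l))"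
proof -
  let ?\<kappa> = "lead_coeff (\<theta> m)" and ?\<kappa>' = "lead_coeff (\<theta> (Suc m))" and ?a = "\<lambda>j. A j $$ (r, s)"
  have "(\<Sum>l\<le>m. (x * [:C1_blocks A m l r s:] - y * [:C0_blocks A m l r s:]) * v l)
    = (\<Sum>l\<le>m. (if l = m then smult (?\<kappa>' * ?a (Suc m)) (x * v l) else 0)
         - smult (?\<kappa>' * ?a (Suc m)) (y * smult (h l m) (v l)) + smult ?\<kappa> (smult (?a l) (y * v l)))"
    by (intro sum.cong)
       (auto simp: C1_blocks_def C0_blocks_def algebra_simps smult_diff_left mult_ac)
  also have "\<dots> = smult (?\<kappa>' * ?a (Suc m)) (x * v m)
      - smult (?\<kappa>' * ?a (Suc m)) (y * (\<Sum>l\<le>m. smult (h l m) (v l)))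
      + smult ?\<kappa> (\<Sum>l\<le>m. smult (?a l) (y * v l))"
    by (simp add: sum.distrib sum_subtractf smult_sum_right sum_distrib_left)
  finally show ?thesis by (simp add: smult_diff_right)
qed

lemma pencil_kills_basis:
  assumes b: "b < m"
  shows "(\<Sum>l\<le>m. (lam * [:C1_blocks A b l r s:] - 1 * [:C0_blocks A b l r s:]) * \<theta> l) = 0"
  unfolding pencil_top[OF b] recurrence_inner[OF b] by simp

text \<open>The last row uses the recurrence for \<open>\<theta> m\<close>: its terms up to \<open>m\<close> cancel, and the
  surviving multiple of \<open>\<theta> (Suc m)\<close> supplies the last summand of the matrix polynomial.\<close>
lemma pencil_last_row_basis:
  "(\<Sum>l\<le>m. (lam * [:C1_blocks A m l r s:] - 1 * [:C0_blocks A m l r s:]) * \<theta> l)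
    = smult (lead_coeff (\<theta> m)) (\<Sum>j\<le>Suc m. smult (A j $$ (r, s)) (\<theta> j))"
proof -
  have rest: "lam * \<theta> m - 1 * (\<Sum>l\<le>m. smult (h l m) (\<theta> l)) = smult (h (Suc m) m) (\<theta> (Suc m))"
    unfolding recurrence[OF order.refl] by simp
  show ?thesis
    unfolding pencil_bottom rest
    by (simp add: smult_add_right add.commute mult_ac lead_coeff_step[symmetric])
qed

text \<open>By the recurrence the sum telescopes to
  \<open>rev_poly c (\<theta> b) - lam * rev_poly c (lam * \<theta> b)\<close>, which leaves a single coefficient of \<open>\<theta> b\<close>.
  This is what makes truncated reversals the right vectors for the reversed pencil.\<close>
lemma reversed_pencil_triangularizes:
  assumes b: "b < m"
  shows "(\<Sum>l\<le>m. (1 * [:C1_blocks A b l r s:] - lam * [:C0_blocks A b l r s:]) * rev_poly c (\<theta> l))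
    = (if r = s then [:coeff (\<theta> b) c:] else 0)"
proof -
  have "(\<Sum>l\<le>m. smult (h l b) (rev_poly c (\<theta> l))) = rev_poly c (lam * \<theta> b)"
    unfolding recurrence_inner[OF b] by (simp only: rev_poly_sum rev_poly_smult)
  moreover have "1 * rev_poly c (\<theta> b) - lam * rev_poly c (lam * \<theta> b) = [:coeff (\<theta> b) c:]"
  proof (cases c)
    case 0
    then show ?thesis by (simp add: rev_poly_zero_grade)
  next
    case (Suc c')
    show ?thesis unfolding Suc rev_poly_Suc_lam by (simp add: rev_poly_Suc)
  qed
  ultimately show ?thesis unfolding pencil_top[OF b] by simp
qed

lemma reversed_pencil_last_row:
  "(\<Sum>l\<le>m. (1 * [:C1_blocks A m l r s:] - lam * [:C0_blocks A m l r s:]) * rev_poly m (\<theta> l))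
    = smult (lead_coeff (\<theta> m)) (rev_poly (Suc m) (\<Sum>j\<le>Suc m. smult (A j $$ (r, s)) (\<theta> j)))"
proof -
  have shift: "lam * rev_poly m (\<theta> l) = rev_poly (Suc m) (\<theta> l)" if "l \<le> m" for l
    using that by (simp add: rev_poly_Suc coeff_eq_0 deg)
  have "rev_poly m (\<theta> m) = rev_poly (Suc m) (lam * \<theta> m)"
    by (rule rev_poly_Suc_lam[symmetric])
  also have "\<dots> = (\<Sum>l\<le>Suc m. smult (h l m) (rev_poly (Suc m) (\<theta> l)))"
    unfolding recurrence[OF order.refl] by (simp only: rev_poly_sum rev_poly_smult)
  also have "\<dots> = lam * (\<Sum>l\<le>m. smult (h l m) (rev_poly m (\<theta> l)))
      + smult (h (Suc m) m) (rev_poly (Suc m) (\<theta> (Suc m)))"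
  proof -
    have "(\<Sum>l\<le>m. smult (h l m) (rev_poly (Suc m) (\<theta> l)))
        = (\<Sum>l\<le>m. smult (h l m) (lam * rev_poly m (\<theta> l)))"
      by (rule sum.cong) (simp_all only: shift atMost_iff)
    then show ?thesis
      unfolding sum_distrib_left mult_smult_right sum.atMost_Suc by (simp only:)
  qed
  finally have rest: "1 * rev_poly m (\<theta> m) - lam * (\<Sum>l\<le>m. smult (h l m) (rev_poly m (\<theta> l)))
      = smult (h (Suc m) m) (rev_poly (Suc m) (\<theta> (Suc m)))"
    by (simp only: mult_1 add_diff_cancel_left')
  have sum: "(\<Sum>l\<le>m. smult (A l $$ (r, s)) (lam * rev_poly m (\<theta> l)))
      = (\<Sum>l\<le>m. smult (A l $$ (r, s)) (rev_poly (Suc m) (\<theta> l)))"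
    by (rule sum.cong) (simp_all only: shift atMost_iff)
  show ?thesis
    unfolding pencil_bottom rest sum
    by (simp add: rev_poly_sum rev_poly_add rev_poly_smult smult_add_right add.commute mult_ac
        lead_coeff_step[symmetric])
qed

text \<open>Because \<open>\<theta> 0 = 1\<close>, the vector of basis polynomials can serve as first column of a
  unitriangular \<open>G\<close>. The pencil maps it to a multiple of \<open>P\<close> in the last block, and deleting the
  first block column of the recurrence rows leaves a triangular matrix whose diagonal is given by
  the subdiagonal of \<open>h\<close>, hence consists of nonzero constants.\<close>
lemma linearization_pencil:
  fixes A :: "nat \<Rightarrow> complex mat" and n :: nat
  defines "P \<equiv> basis_matpoly n (Suc m) \<theta> A"
    and "L \<equiv> block_mat n (Suc m) (Suc m)
      (\<lambda>b c r s. lam * [:C1_blocks A b c r s:] - 1 * [:C0_blocks A b c r s:])"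
  assumes n: "n > 0"
  shows "\<exists>D G. unimodular_matpoly (Suc m * n) D \<and> unimodular_matpoly (Suc m * n) G \<and>
    block_diag P (1\<^sub>m (m * n)) = D * L * G"
proof -
  define G where "G = (\<lambda>b c. if c = 0 then \<theta> b else if b = c then 1 else 0)"
  let ?G = "block_mat n (Suc m) (Suc m) (scalar_blocks G)"
  define LG where "LG = (\<lambda>b c r s.
    \<Sum>l\<le>m. (lam * [:C1_blocks A b l r s:] - 1 * [:C0_blocks A b l r s:]) * G l c)"
  have G: "unimodular_matpoly (Suc m * n) ?G"
    by (rule unimodular_scalar_blocks_lower[OF n]) (auto simp: G_def start)
  have later: "LG b (Suc c) r s = lam * [:C1_blocks A b (Suc c) r s:] - [:C0_blocks A b (Suc c) r s:]"
    if "c < m" for b c r s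
    using that by (simp add: LG_def G_def if_distrib[of "\<lambda>x. _ * x"] cong: if_cong)
  have first: "LG b 0 r s = 0" if "b < m" for b r s
    unfolding LG_def G_def using pencil_kills_basis[OF that] by (simp only: if_True refl)
  have corner: "LG m 0 r s
      = smult (lead_coeff (\<theta> m)) (\<Sum>j\<le>Suc m. smult (A j $$ (r, s)) (\<theta> j))" for r s
    unfolding LG_def G_def using pencil_last_row_basis by (simp only: if_True refl)
  define M where "M = block_mat n m m (scalar_blocks (\<lambda>b c.
      (if b = Suc c then lam else 0) - [:h (Suc c) b:]))"
  have M: "unimodular_matpoly (m * n) M"
    unfolding M_def
    by (rule unimodular_scalar_blocks_lower[OF n])
       (auto simp: hess subdiag is_unit_pCons_iff)
  define W where "W = block_mat n 1 m (\<lambda>b c. LG (m + b) (1 + c))"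
  have "L * ?G = block_mat n (m + 1) (1 + m) LG"
    unfolding L_def block_mat_times_scalar_blocks LG_def lessThan_Suc_atMost by simp
  also have "\<dots> = four_block_mat (0\<^sub>m (m * n) n) M ([:lead_coeff (\<theta> m):] \<cdot>\<^sub>m P) W"
    unfolding block_mat_split
  proof (rule arg_cong4[where f = four_block_mat])
    show "block_mat n m 1 LG = 0\<^sub>m (m * n) n"
      using n
      by (intro eq_matI) (auto simp: block_mat_def first less_mult_imp_div_less)
    show "block_mat n m m (\<lambda>b c. LG b (1 + c)) = M"
      unfolding M_def
      by (rule block_mat_cong)
         (auto simp: later C1_blocks_def C0_blocks_def scalar_blocks_def)
    show "block_mat n 1 1 (\<lambda>b. LG (m + b)) = [:lead_coeff (\<theta> m):] \<cdot>\<^sub>m P"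
      using n
      by (intro eq_matI) (auto simp: block_mat_def corner P_def basis_matpoly_def simp del: sum.atMost_Suc)
  qed (simp add: W_def)
  finally have LG: "L * ?G = four_block_mat (0\<^sub>m (m * n) n) M ([:lead_coeff (\<theta> m):] \<cdot>\<^sub>m P) W" .
  have N: "Suc m * n = m * n + n" by simp
  have P: "P \<in> carrier_mat n n" by (simp add: P_def basis_matpoly_def)
  have W: "W \<in> carrier_mat n (m * n)" using block_mat_carrier[of n 1 m] by (simp add: W_def)
  have L: "L \<in> carrier_mat (m * n + n) (m * n + n)"
    unfolding L_def N[symmetric] by (rule block_mat_carrier)
  show ?thesis
    using equivalent_block_diag_left[OF P M W lead_coeff_nonzero L _ LG] G unfolding N by simp
qed

text \<open>No entry of the vector of reversed basis polynomials needs to be constant, so it is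
  completed to a unimodular matrix differently: column \<open>c\<close> of \<open>G\<close> consists of the reversals
  \<open>rev_poly c (\<theta> b)\<close>. The recurrence rows of the reversed pencil turn \<open>G\<close> into the
  triangular matrix of coefficients of the \<open>\<theta> b\<close>, whose last column vanishes there.\<close>
lemma linearization_reversed_pencil:
  fixes A :: "nat \<Rightarrow> complex mat" and n :: nat
  defines "P \<equiv> basis_matpoly n (Suc m) \<theta> A"
    and "L \<equiv> block_mat n (Suc m) (Suc m)
      (\<lambda>b c r s. 1 * [:C1_blocks A b c r s:] - lam * [:C0_blocks A b c r s:])"
  assumes n: "n > 0"
  shows "\<exists>D G. unimodular_matpoly (Suc m * n) D \<and> unimodular_matpoly (Suc m * n) G \<and>
    block_diag (rev_matpoly (Suc m) P) (1\<^sub>m (m * n)) = D * L * G"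
proof -
  define S where "S = (\<lambda>b c. [:coeff (\<theta> b) c:])"
  define U where "U = (\<lambda>l c. if l \<le> c then monom 1 (c - l) else (0 :: complex poly))"
  define G where "G = (\<lambda>b c. rev_poly c (\<theta> b))"
  let ?G = "block_mat n (Suc m) (Suc m) (scalar_blocks G)"
  define LG where "LG = (\<lambda>b c r s.
    \<Sum>l\<le>m. (1 * [:C1_blocks A b l r s:] - lam * [:C0_blocks A b l r s:]) * G l c)"
  have top: "LG b c r s = (if r = s then [:coeff (\<theta> b) c:] else 0)" if "b < m" for b c r s
    unfolding LG_def G_def by (rule reversed_pencil_triangularizes[OF that])
  have corner: "LG m m r s = smult (lead_coeff (\<theta> m))
      (rev_poly (Suc m) (\<Sum>j\<le>Suc m. smult (A j $$ (r, s)) (\<theta> j)))" for r s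
    unfolding LG_def G_def by (rule reversed_pencil_last_row)
  have vanish: "coeff (\<theta> b) m = 0" if "b < m" for b
    using that by (intro coeff_eq_0) (simp add: deg)
  have S: "unimodular_matpoly (N * n) (block_mat n N N (scalar_blocks S))" if "N \<le> Suc m" for N
    by (rule unimodular_scalar_blocks_lower[OF n])
       (use that lead_coeff_nonzero in \<open>auto simp: S_def deg coeff_eq_0 is_unit_pCons_iff\<close>)
  have U: "unimodular_matpoly (Suc m * n) (block_mat n (Suc m) (Suc m) (scalar_blocks U))"
    by (rule unimodular_scalar_blocks_upper[OF n]) (auto simp: U_def)
  \<comment> \<open>\<open>G = S U\<close> expands each \<open>rev_poly c (\<theta> b)\<close> in powers of the variable; as \<open>S\<close> and \<open>U\<close> are
    triangular with constant diagonals, \<open>G\<close> is unimodular.\<close>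
  have "(\<Sum>l<Suc m. S b l * U l c) = G b c" if "c < Suc m" for b c
  proof -
    have "(\<Sum>l<Suc m. S b l * U l c) = (\<Sum>l\<le>c. S b l * U l c)"
      using that by (intro sum.mono_neutral_right) (auto simp: U_def)
    also have "\<dots> = G b c"
      by (auto simp: S_def U_def G_def rev_poly_def smult_monom intro!: sum.cong)
    finally show ?thesis .
  qed
  then have "block_mat n (Suc m) (Suc m) (scalar_blocks S) * block_mat n (Suc m) (Suc m) (scalar_blocks U) = ?G"
    unfolding block_mat_times_scalar_blocks
    by (intro block_mat_cong) (auto simp: scalar_blocks_def simp del: sum.lessThan_Suc)
  then have G: "unimodular_matpoly (Suc m * n) ?G"
    using unimodular_matpoly_mult[OF S U] by simp
  define M where "M = block_mat n m m (scalar_blocks S)"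
  define W where "W = block_mat n 1 m (\<lambda>b. LG (m + b))"
  have "L * ?G = block_mat n (m + 1) (m + 1) LG"
    unfolding L_def block_mat_times_scalar_blocks LG_def lessThan_Suc_atMost by simp
  also have "\<dots> = four_block_mat M (0\<^sub>m (m * n) n) W ([:lead_coeff (\<theta> m):] \<cdot>\<^sub>m rev_matpoly (Suc m) P)"
    unfolding block_mat_split
  proof (rule arg_cong4[where f = four_block_mat])
    show "block_mat n m m LG = M"
      unfolding M_def
      by (rule block_mat_cong)
         (auto simp: top S_def scalar_blocks_def)
    show "block_mat n m 1 (\<lambda>b c. LG b (m + c)) = 0\<^sub>m (m * n) n"
      using n
      by (intro eq_matI)
         (auto simp: block_mat_def top vanish less_mult_imp_div_less)
    show "block_mat n 1 1 (\<lambda>b c. LG (m + b) (m + c)) = [:lead_coeff (\<theta> m):] \<cdot>\<^sub>m rev_matpoly (Suc m) P"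
      using n
      by (intro eq_matI) (auto simp: block_mat_def corner P_def basis_matpoly_def rev_matpoly_def
          simp del: sum.atMost_Suc)
  qed (simp add: W_def)
  finally have LG: "L * ?G
    = four_block_mat M (0\<^sub>m (m * n) n) W ([:lead_coeff (\<theta> m):] \<cdot>\<^sub>m rev_matpoly (Suc m) P)" .
  have N: "Suc m * n = m * n + n" by simp
  have P: "rev_matpoly (Suc m) P \<in> carrier_mat n n"
    by (simp add: P_def basis_matpoly_def rev_matpoly_def)
  have M: "unimodular_matpoly (m * n) M" using S[of m] by (simp add: M_def)
  have W: "W \<in> carrier_mat n (m * n)" using block_mat_carrier[of n 1 m] by (simp add: W_def)
  have L: "L \<in> carrier_mat (m * n + n) (m * n + n)"
    unfolding L_def N[symmetric] by (rule block_mat_carrier)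
  show ?thesis
    using equivalent_block_diag_right[OF P M W lead_coeff_nonzero L _ LG] G unfolding N by simp
qed

lemma strong_linearization_blocks:
  assumes n: "n > 0" and reg: "regular_matpoly (basis_matpoly n (Suc m) \<theta> A)"
  shows "strong_linearization n (Suc m) (basis_matpoly n (Suc m) \<theta> A)
    (block_mat n (Suc m) (Suc m) (C1_blocks A)) (block_mat n (Suc m) (Suc m) (C0_blocks A))"
proof -
  let ?C1 = "block_mat n (Suc m) (Suc m) (C1_blocks A)"
  let ?C0 = "block_mat n (Suc m) (Suc m) (C0_blocks A)"
  have pencils: "lam \<cdot>\<^sub>m const_matpoly ?C1 - const_matpoly ?C0 = block_mat n (Suc m) (Suc m)
      (\<lambda>b c r s. lam * [:C1_blocks A b c r s:] - 1 * [:C0_blocks A b c r s:])"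
    "const_matpoly ?C1 - lam \<cdot>\<^sub>m const_matpoly ?C0 = block_mat n (Suc m) (Suc m)
      (\<lambda>b c r s. 1 * [:C1_blocks A b c r s:] - lam * [:C0_blocks A b c r s:])"
    by (rule eq_matI; simp add: block_mat_def)+
  have "has_grade (Suc m) (basis_matpoly n (Suc m) \<theta> A)"
    by (auto simp: has_grade_def basis_matpoly_def deg simp del: sum.atMost_Suc
        intro!: degree_sum_le order.trans[OF degree_smult_le])
  moreover have "basis_matpoly n (Suc m) \<theta> A \<in> carrier_mat n n"
    by (simp add: basis_matpoly_def)
  ultimately show ?thesis
    unfolding strong_linearization_def pencils diff_Suc_1
    using reg linearization_pencil[OF n] linearization_reversed_pencil[OF n] block_mat_carrier
    by blast
qed

end

section \<open>The pencil of the Vandermonde-with-Arnoldi basis\<close>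

lemma dim_submatrix_subset:
  assumes "I \<subseteq> {..<dim_row A}" "J \<subseteq> {..<dim_col A}"
  shows "dim_row (submatrix A I J) = card I" "dim_col (submatrix A I J) = card J"
proof -
  have "{i. i < dim_row A \<and> i \<in> I} = I" "{j. j < dim_col A \<and> j \<in> J} = J"
    using assms by auto
  then show "dim_row (submatrix A I J) = card I" "dim_col (submatrix A I J) = card J"
    by (simp_all add: dim_submatrix)
qed

lemma submatrix_initial_index:
  assumes "i < I" "j < J" "I \<le> dim_row A" "J \<le> dim_col A"
  shows "submatrix A {..<I} {..<J} $$ (i, j) = A $$ (i, j)"
proof -
  have "{a \<in> {..<I}. a < i} = {..<i}" "{a \<in> {..<J}. a < j} = {..<j}" using assms by auto
  then show ?thesis
    using submatrix_index_card[of i A j "{..<I}" "{..<J}"] assms by simp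
qed

lemma submatrix_column_index:
  assumes "i < I" "I \<le> dim_row A" "j < dim_col A"
  shows "submatrix A {..<I} {j} $$ (i, 0) = A $$ (i, j)"
proof -
  have "{a \<in> {..<I}. a < i} = {..<i}" using assms by auto
  moreover have "{a \<in> {j}. a < j} = {}" by auto
  moreover have "submatrix A {..<I} {j} $$ (card {a \<in> {..<I}. a < i}, card {a \<in> {j}. a < j}) = A $$ (i, j)"
    by (rule submatrix_index_card) (use assms in auto)
  ultimately show ?thesis by (simp only: card_lessThan card.empty)
qed

theorem proposition4p1:
  fixes \<Omega> :: "complex set" and n s d \<gamma> :: nat and N :: "nat \<Rightarrow> nat"
    and E :: "nat \<Rightarrow> complex mat" and t :: "nat \<Rightarrow> complex \<Rightarrow> complex"
    and X :: "complex set" and p :: "nat \<Rightarrow> complex poly" and q :: "complex poly"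
    and \<theta> :: "nat \<Rightarrow> complex poly" and H :: "complex mat"
    and a :: "nat \<Rightarrow> nat \<Rightarrow> complex" and A :: "nat \<Rightarrow> complex mat"
    and k :: "nat \<Rightarrow> complex" and P :: "complex poly mat" and C\<^sub>0 C\<^sub>1 :: "complex mat"
  assumes n: "n \<ge> 1" and s: "s \<ge> 1"
    and Omega: "jordan_domain \<Omega>"
    and E: "\<And>i. i \<in> {1..s} \<Longrightarrow> E i \<in> carrier_mat n n"
    and t: "\<And>i. i \<in> {1..s} \<Longrightarrow> t i analytic_on \<Omega> \<and> continuous_on (closure \<Omega>) (t i)"
    and X: "finite X" "X \<subseteq> closure \<Omega>" "card X \<ge> (MAX i\<in>{1..s}. N i + d + 2)"
    and xi: "rational_minimax_solution s t N d X p q"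
    and q: "\<And>x. x \<in> closure \<Omega> \<Longrightarrow> poly q x \<noteq> 0"
    and gamma: "\<gamma> = max (MAX i\<in>{1..s}. N i) d" "\<gamma> \<ge> 1"
    and basis: "VA_basis X \<gamma> \<theta> H"
    and a: "\<And>i. i \<in> {1..s} \<Longrightarrow> p i = (\<Sum>j\<le>\<gamma>. smult (a i j) (\<theta> j))"
    and A: "A = coeff_matrix n s a E"
    and k: "\<And>j. k j = lead_coeff (\<theta> j)"
    and P: "P = basis_matpoly n \<gamma> \<theta> A"
    and regular: "regular_matpoly P"
    and C0: "C\<^sub>0 =
      kronecker (transpose_mat (submatrix H {..<\<gamma>} {..<\<gamma> - 1})) (1\<^sub>m n) @\<^sub>r
      (- k (\<gamma> - 1) \<cdot>\<^sub>m block_row n \<gamma> A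
         + k \<gamma> \<cdot>\<^sub>m kronecker (transpose_mat (submatrix H {..<\<gamma>} {\<gamma> - 1})) (A \<gamma>))"
    and C1: "C\<^sub>1 = block_diag (1\<^sub>m ((\<gamma> - 1) * n)) (k \<gamma> \<cdot>\<^sub>m A \<gamma>)"
  shows "strong_linearization n \<gamma> P C\<^sub>1 C\<^sub>0"
proof -
  define m where "m = \<gamma> - 1"
  have g: "\<gamma> = Suc m" using gamma(2) by (simp add: m_def)
  have n0: "n > 0" using n by simp
  interpret hessenberg_recurrence m "\<lambda>i j. H $$ (i, j)" \<theta>
    using basis by unfold_locales (auto simp: VA_basis_def g)
  have H: "dim_row H = m + 3" "dim_col H = m + 2"
    using basis by (auto simp: VA_basis_def g)
  have Ac: "A j \<in> carrier_mat n n" for j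
    by (simp add: A coeff_matrix_def)
  have dims: "dim_row (submatrix H {..<Suc m} {..<m}) = Suc m" "dim_col (submatrix H {..<Suc m} {..<m}) = m"
    "dim_row (submatrix H {..<Suc m} {m}) = Suc m" "dim_col (submatrix H {..<Suc m} {m}) = 1"
    using dim_submatrix_subset[of "{..<Suc m}" H "{..<m}"] dim_submatrix_subset[of "{..<Suc m}" H "{m}"]
    by (auto simp: H)
  have split: "i div n < m \<longleftrightarrow> i < m * n" for i
    using n0 by (simp add: div_less_iff_less_mult)
  have shift: "i div n = m" "i - m * n = i mod n" if "\<not> i < m * n" "i < Suc m * n" for i
  proof -
    have "i div n \<ge> m" "i div n < Suc m"
      using that split[of i] less_mult_imp_div_less[OF that(2)] by auto
    then show "i div n = m" by simp
    then show "i - m * n = i mod n" by (simp add: minus_div_mult_eq_mod[symmetric])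
  qed
  \<comment> \<open>It remains to identify the entries of the given matrices with the block descriptions.\<close>
  have "C\<^sub>1 = block_mat n (Suc m) (Suc m) (C1_blocks A)"
  proof (rule eq_matI)
    fix i j assume "i < dim_row (block_mat n (Suc m) (Suc m) (C1_blocks A))"
      and "j < dim_col (block_mat n (Suc m) (Suc m) (C1_blocks A))"
    then have ij: "i < Suc m * n" "j < Suc m * n" by simp_all
    have "i = j \<longleftrightarrow> i div n = j div n \<and> i mod n = j mod n" by (metis div_mult_mod_eq)
    then show "C\<^sub>1 $$ (i, j) = block_mat n (Suc m) (Suc m) (C1_blocks A) $$ (i, j)"
      using ij Ac[of "Suc m"] shift[of i] shift[of j] split[of i] split[of j]
      by (auto simp: C1 g k block_diag_def block_mat_def C1_blocks_def)
  qed (use Ac[of "Suc m"] in \<open>simp_all add: C1 g block_diag_def\<close>)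
  moreover have "C\<^sub>0 = block_mat n (Suc m) (Suc m) (C0_blocks A)"
  proof (rule eq_matI)
    fix i j assume "i < dim_row (block_mat n (Suc m) (Suc m) (C0_blocks A))"
      and "j < dim_col (block_mat n (Suc m) (Suc m) (C0_blocks A))"
    then have ij: "i < Suc m * n" "j < Suc m * n" by simp_all
    have jd: "j div n < Suc m" using ij by (simp add: less_mult_imp_div_less)
    show "C\<^sub>0 $$ (i, j) = block_mat n (Suc m) (Suc m) (C0_blocks A) $$ (i, j)"
    proof (cases "i < m * n")
      case True
      then have "i div n < m" by (simp add: split)
      then show ?thesis
        using True ij jd n0 Ac[of "Suc m"]
        by (simp add: C0 g k append_rows_def kronecker_def block_row_def block_mat_def C0_blocks_def
            dims submatrix_initial_index H)
    next
      case False
      then have i: "i - m * n = i mod n" "i div n = m" using shift[of i] ij by auto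
      then show ?thesis
        using False ij jd n0 Ac[of "Suc m"]
        by (simp add: C0 g k append_rows_def kronecker_def block_row_def block_mat_def C0_blocks_def
            dims submatrix_column_index H)
    qed
  qed (use Ac[of "Suc m"] in \<open>simp_all add: C0 g append_rows_def kronecker_def block_row_def dims\<close>)
  ultimately show ?thesis
    using strong_linearization_blocks[OF n0, of A] regular by (simp add: P g)
qed

end
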